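(* Let $A$ be a finite non-empty subset of a commutative group and let $h\geq 2$ be a fixed integer. Let $\alpha$ be a real number with $|hA| \leq \alpha|A|$ and suppose that $|(h+1)A| \geq \frac{1}{M}\alpha^{\frac{h+1}{h}}|A|^{\frac{h+1}{h}}$, where $M$ is a real number with $1\leq M \leq \frac{1}{2h}\left(\frac{|A|}{\alpha^{\frac{1}{h-1}}}\right)^{\frac{1}{h}}$. Then there exists $Y \subset A$ such that (1) $\displaystyle \frac{(\alpha|A|)^{\frac{1}{h}}}{(2M)^{\frac{1}{h}}} \leq |Y| < (2Mh)^{h-1}(\alpha|A|)^{\frac{1}{h}}$, and (2) $\displaystyle |(h+1)Y| \geq \frac{|Y|^{h+1}}{(2M)^{h^2}h^{h^2-1}}$.
   Context: For a subset $A$ of a commutative group (written additively) and an integer $k\geq 2$, the iterated sumset is $kA=\{a_1+\cdots+a_k : a_1,\ldots,a_k\in A\}$; $|\cdot|$ denotes cardinality. The inclusion $Y\subset A$ is not required to be proper. *)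

theory Defs
  imports Complex_Main
begin

definition iterated_sumset :: "nat \<Rightarrow> 'a::ab_group_add set \<Rightarrow> 'a set"
  where "iterated_sumset k A = {(\<Sum>i<k. a i) | a. \<forall>i<k. a i \<in> A}"

end

theory Submission
  imports Defs "HOL-Analysis.Convex"
begin

text \<open>
  Let \<open>q\<close> be the \<open>h\<close>-th root of \<open>\<alpha>|A|\<close>, so that \<open>|hA| \<le> q ^ h\<close> and \<open>|(h+1)A| \<ge> q ^ (h+1) / M\<close>.
  The theorem follows once some \<open>Y \<subseteq> A\<close> of size about \<open>K = (2Mh) ^ (h-1) q\<close> has
  \<open>|(h+1)Y| \<ge> q ^ (h+1) / (2M)\<close>, that is, once replacing \<open>A\<close> by \<open>Y\<close> loses at most half of the
  guaranteed size of \<open>(h+1)A\<close>: the right-hand side of (2) is the value of this bound at \<open>|Y| = K\<close>,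
  and the lower bound in (1) follows from \<open>|(h+1)Y| \<le> |Y| ^ (h+1)\<close>. The upper bound on \<open>M\<close>
  says exactly that \<open>K \<le> |A|\<close>, so that a subset of this size exists.

  To control the loss, fix a well-order and represent each element of \<open>kA\<close>, for every \<open>k\<close>, by the
  lexicographically least list of \<open>k\<close> elements of \<open>A\<close> with that sum. Deleting an entry of such a
  list leaves a list of the same kind (\<open>hereditary_representatives\<close>). For \<open>a \<in> A\<close> let \<open>g(a)\<close> and
  \<open>G(a)\<close> be the numbers of representatives containing \<open>a\<close> of length \<open>h\<close> and \<open>h+1\<close>. Taking
  one \<open>a\<close> out of the lists counted by \<open>G(a)\<close> gives a set of \<open>h\<close>-tuples all of whose coordinate
  projections have size at most \<open>g(a)\<close>, so the Loomis--Whitney inequality yields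
  \<open>G(a) ^ (h-1) \<le> g(a) ^ h\<close> (\<open>card_representatives_through_point\<close>).

  Let \<open>Y\<close> consist of the \<open>k\<close> elements of \<open>A\<close> with the largest \<open>g(a)\<close>. Every element of \<open>(h+1)A\<close>
  outside \<open>(h+1)Y\<close> has its representative run through some \<open>a \<notin> Y\<close>, hence the loss is at most the sum of
  \<open>G(a)\<close> over \<open>a \<notin> Y\<close>. With \<open>P\<close> and \<open>U\<close> the sums of \<open>g\<close> over \<open>Y\<close> and over \<open>A - Y\<close>, double
  counting gives \<open>P + U \<le> h|hA|\<close>, and \<open>g(a) \<le> P/k\<close> for \<open>a \<notin> Y\<close>. Therefore
  \<open>loss ^ (h-1) \<le> (P/k) U ^ (h-1)\<close>, and the inequality of arithmetic and geometric means bounds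
  this by \<open>(h-1) ^ (h-1) |hA| ^ h / k\<close> (\<open>ex_subset_capturing_sumset\<close>). Taking for \<open>k\<close> the
  largest integer below \<open>K\<close>, this is enough, because \<open>k \<ge> K/2\<close> and
  \<open>2 (h-1) ^ (h-1) \<le> h ^ (h-1)\<close>.
\<close>

section \<open>The Loomis--Whitney inequality for lists\<close>

lemma prod_le_mean_power:
  fixes x :: "nat \<Rightarrow> real"
  assumes "n > 0" and nonneg: "\<And>j. j < n \<Longrightarrow> x j \<ge> 0"
  shows "(\<Prod>j<n. x j) \<le> ((\<Sum>j<n. x j) / n) ^ n"
proof -
  let ?p = "\<Prod>j<n. x j"
  have p: "?p \<ge> 0"
    using nonneg by (intro prod_nonneg) auto
  have root_power: "(y powr (1 / n)) ^ n = y" if "y \<ge> 0" for y :: real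
    using that \<open>n > 0\<close> by (cases "y = 0") (auto simp: powr_power)
  have "?p powr (1 / n) \<le> (\<Sum>j<n. x j / n)"
    using arith_geom_mean[of "{..<n}" x] assms by auto
  then have "(?p powr (1 / n)) ^ n \<le> (\<Sum>j<n. x j / n) ^ n"
    by (intro power_mono) auto
  also have "(?p powr (1 / n)) ^ n = ?p"
    by (rule root_power[OF p])
  finally show ?thesis
    by (simp add: sum_divide_distrib)
qed

text \<open>
  For \<open>p j a = f j a ^ n\<close> this is Hoelder's inequality for the \<open>n\<close> functions \<open>f j\<close> with all
  exponents equal to \<open>n\<close>. After division of each \<open>p j\<close> by its sum over \<open>I\<close>, the pointwise
  arithmetic-geometric mean inequality turns the product into an average, whose sum over \<open>I\<close> is 1.
\<close>
lemma sum_power_le_prod_sum: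
  fixes c :: "'a \<Rightarrow> real" and p :: "nat \<Rightarrow> 'a \<Rightarrow> real"
  assumes "finite I" and "n > 0" and "P \<ge> 0"
    and c: "\<And>a. a \<in> I \<Longrightarrow> c a \<ge> 0"
    and p: "\<And>j a. j < n \<Longrightarrow> a \<in> I \<Longrightarrow> p j a \<ge> 0"
    and le: "\<And>a. a \<in> I \<Longrightarrow> c a ^ n \<le> P * (\<Prod>j<n. p j a)"
  shows "(\<Sum>a\<in>I. c a) ^ n \<le> P * (\<Prod>j<n. \<Sum>a\<in>I. p j a)"
proof -
  define Q where "Q j = (\<Sum>a\<in>I. p j a)" for j
  have Q: "Q j \<ge> 0" if "j < n" for j
    unfolding Q_def using p that by (intro sum_nonneg) auto
  show ?thesis
  proof (cases "\<exists>j<n. Q j = 0")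
    case True
    then obtain j where j: "j < n" "Q j = 0" by blast
    then have "p j a = 0" if "a \<in> I" for a
      using p \<open>finite I\<close> that unfolding Q_def by (subst (asm) sum_nonneg_eq_0_iff) auto
    then have prod_0: "(\<Prod>j<n. p j a) = 0" if "a \<in> I" for a
      using j that by (intro prod_zero) auto
    have "c a ^ n \<le> 0" if "a \<in> I" for a
      using le[OF that] unfolding prod_0[OF that] by simp
    then have "c a = 0" if "a \<in> I" for a
      using c[OF that] that \<open>n > 0\<close> by (metis less_eq_real_def not_le zero_less_power)
    then have "(\<Sum>a\<in>I. c a) ^ n = 0"
      using \<open>n > 0\<close> by simp
    then show ?thesis
      using Q \<open>P \<ge> 0\<close> unfolding Q_def[symmetric] by (auto simp del: power_eq_0_iff intro!: mult_nonneg_nonneg prod_nonneg)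
  next
    case False
    then have Qpos: "Q j > 0" if "j < n" for j
      using Q[OF that] that by force
    then have Qne: "Q j \<noteq> 0" if "j < n" for j
      using that by force
    define R where "R = P * (\<Prod>j<n. Q j)"
    have R: "R \<ge> 0"
      unfolding R_def using Q \<open>P \<ge> 0\<close> by (intro mult_nonneg_nonneg prod_nonneg) auto
    define s where "s a = (\<Sum>j<n. p j a / Q j) / n" for a
    have s: "s a \<ge> 0" if "a \<in> I" for a
      unfolding s_def using p that Q by (intro divide_nonneg_nonneg sum_nonneg) auto
    have bound: "c a \<le> root n R * s a" if a: "a \<in> I" for a
    proof -
      have "c a ^ n \<le> P * (\<Prod>j<n. p j a)"
        by (rule le[OF a])
      also have "(\<Prod>j<n. p j a) = (\<Prod>j<n. Q j * (p j a / Q j))"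
        by (intro prod.cong) (auto simp: Qne)
      also have "P * \<dots> = R * (\<Prod>j<n. p j a / Q j)"
        by (simp add: R_def prod.distrib del: times_divide_eq_right)
      also have "\<dots> \<le> R * s a ^ n"
        unfolding s_def using R p a Q \<open>n > 0\<close>
        by (intro mult_left_mono prod_le_mean_power) auto
      also have "\<dots> = (root n R * s a) ^ n"
        using R \<open>n > 0\<close> by (simp add: power_mult_distrib)
      finally show ?thesis
        using power_le_imp_le_base[of "c a" "n - 1" "root n R * s a"] \<open>n > 0\<close> R s[OF a] by simp
    qed
    have "(\<Sum>a\<in>I. s a) = (\<Sum>a\<in>I. \<Sum>j<n. p j a / Q j) / n"
      unfolding s_def by (rule sum_divide_distrib[symmetric])
    also have "(\<Sum>a\<in>I. \<Sum>j<n. p j a / Q j) = (\<Sum>j<n. \<Sum>a\<in>I. p j a / Q j)"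
      by (rule sum.swap)
    also have "(\<Sum>j<n. \<Sum>a\<in>I. p j a / Q j) = (\<Sum>j<n. 1)"
      by (intro sum.cong) (auto simp: sum_divide_distrib[symmetric] Q_def[symmetric] Qne)
    finally have "(\<Sum>a\<in>I. s a) = 1"
      using \<open>n > 0\<close> by simp
    moreover have "(\<Sum>a\<in>I. c a) \<le> (\<Sum>a\<in>I. root n R * s a)"
      by (intro sum_mono bound)
    ultimately have "(\<Sum>a\<in>I. c a) \<le> root n R"
      by (simp add: sum_distrib_left[symmetric])
    then have "(\<Sum>a\<in>I. c a) ^ n \<le> root n R ^ n"
      using c by (intro power_mono sum_nonneg) auto
    then show ?thesis
      using R \<open>n > 0\<close> by (simp add: R_def Q_def)
  qed
qed

definition del_nth :: "nat \<Rightarrow> 'a list \<Rightarrow> 'a list"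
  where "del_nth j xs = take j xs @ drop (Suc j) xs"

lemma del_nth_Cons_0 [simp]: "del_nth 0 (x # xs) = xs"
  by (simp add: del_nth_def)

lemma del_nth_Cons_Suc [simp]: "del_nth (Suc j) (x # xs) = x # del_nth j xs"
  by (simp add: del_nth_def)

lemma del_nth_append:
  "del_nth j (us @ vs) =
    (if j < length us then del_nth j us @ vs else us @ del_nth (j - length us) vs)"
  by (auto simp: del_nth_def Suc_diff_le)

text \<open>
  Induction on the dimension: slice \<open>S\<close> by the head of the lists. Each slice is contained in the
  projection of \<open>S\<close> that forgets the head, and satisfies the inequality one dimension lower; the
  other projections of \<open>S\<close> are disjoint unions of the projections of the slices, so Hoelder's
  inequality sums up the product of these two bounds. For \<open>n = 0\<close> the inequality reads
  \<open>1 \<le> card (del_nth 0 ` S)\<close>, which needs a nonempty \<open>S\<close>.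
\<close>
lemma loomis_whitney_lists:
  fixes S :: "'a list set"
  assumes "finite S" and "S \<noteq> {}" and "\<And>xs. xs \<in> S \<Longrightarrow> length xs = Suc n"
  shows "real (card S) ^ n \<le> (\<Prod>j<Suc n. real (card (del_nth j ` S)))"
  using assms
proof (induction n arbitrary: S)
  case 0
  have "card (del_nth 0 ` S) > 0"
    using 0 by (simp add: card_gt_0_iff)
  then show ?case by simp
next
  case (Suc n)
  define T where "T a = {ys. a # ys \<in> S}" for a
  define I where "I = hd ` S"
  have S_eq: "S = (\<Union>a\<in>I. (#) a ` T a)"
  proof (intro equalityI subsetI)
    fix xs assume "xs \<in> S"
    moreover from this obtain a ys where "xs = a # ys"
      using Suc.prems(3) by (metis length_Suc_conv)
    ultimately show "xs \<in> (\<Union>a\<in>I. (#) a ` T a)"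
      unfolding I_def T_def by force
  qed (auto simp: T_def)
  have finI: "finite I"
    unfolding I_def using Suc.prems by simp
  have TS: "(#) a ` T a \<subseteq> S" for a
    unfolding T_def by blast
  have finT: "finite (T a)" for a
    by (rule finite_imageD[OF finite_subset[OF TS \<open>finite S\<close>]]) simp
  have T_ne: "T a \<noteq> {}" if a: "a \<in> I" for a
  proof -
    obtain xs where "xs \<in> S" "a = hd xs"
      using a unfolding I_def by blast
    moreover from this have "xs \<noteq> []"
      using Suc.prems(3) by fastforce
    ultimately have "tl xs \<in> T a"
      unfolding T_def by simp
    then show ?thesis by blast
  qed
  have T_len: "length ys = Suc n" if "ys \<in> T a" for a ys
    using Suc.prems(3) that unfolding T_def by fastforce
  have card_slices: "card (\<Union>a\<in>I. (#) a ` U a) = (\<Sum>a\<in>I. card (U a))"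
    if "\<And>a. finite (U a)" for U :: "'a \<Rightarrow> 'a list set"
    using finI that by (subst card_UN_disjoint) (auto simp: card_image)
  define P where "P = real (card (del_nth 0 ` S))"
  have "real (card (T a)) ^ Suc n \<le> P * (\<Prod>j<Suc n. real (card (del_nth j ` T a)))"
    if a: "a \<in> I" for a
  proof -
    have "T a = del_nth 0 ` (#) a ` T a"
      by (simp add: image_image)
    then have "T a \<subseteq> del_nth 0 ` S"
      using TS by blast
    then have "real (card (T a)) \<le> P"
      unfolding P_def using Suc.prems(1) by (simp add: card_mono)
    moreover have "real (card (T a)) ^ n \<le> (\<Prod>j<Suc n. real (card (del_nth j ` T a)))"
      using T_len by (intro Suc.IH finT T_ne[OF a])
    ultimately show ?thesis
      unfolding power_Suc by (intro mult_mono) (auto simp: P_def)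
  qed
  then have "(\<Sum>a\<in>I. real (card (T a))) ^ Suc n \<le>
      P * (\<Prod>j<Suc n. \<Sum>a\<in>I. real (card (del_nth j ` T a)))"
    using finI by (intro sum_power_le_prod_sum) (auto simp: P_def)
  also have "(\<Sum>a\<in>I. real (card (T a))) = real (card S)"
    by (subst S_eq, subst card_slices) (auto simp: finT)
  also have "(\<Prod>j<Suc n. \<Sum>a\<in>I. real (card (del_nth j ` T a))) =
      (\<Prod>j<Suc n. real (card (del_nth (Suc j) ` S)))"
  proof (rule prod.cong)
    fix j
    have "del_nth (Suc j) ` S = (\<Union>a\<in>I. (#) a ` del_nth j ` T a)"
      by (subst S_eq) (simp add: image_UN image_image)
    then show "(\<Sum>a\<in>I. real (card (del_nth j ` T a))) = real (card (del_nth (Suc j) ` S))"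
      by (simp add: card_slices finT)
  qed simp
  also have "P * (\<Prod>j<Suc n. real (card (del_nth (Suc j) ` S))) =
      (\<Prod>j<Suc (Suc n). real (card (del_nth j ` S)))"
    unfolding P_def by (subst prod.lessThan_Suc_shift) simp
  finally show ?case .
qed

section \<open>Hereditary representatives for sumsets\<close>

lemma iterated_sumset_eq_sum_list:
  "iterated_sumset k A = sum_list ` {xs. set xs \<subseteq> A \<and> length xs = k}"
proof (intro equalityI subsetI)
  fix s assume "s \<in> iterated_sumset k A"
  then obtain a where a: "s = (\<Sum>i<k. a i)" "\<forall>i<k. a i \<in> A"
    unfolding iterated_sumset_def by blast
  then have "s = sum_list (map a [0..<k])"
    by (simp add: interv_sum_list_conv_sum_set_nat atLeast0LessThan)
  then show "s \<in> sum_list ` {xs. set xs \<subseteq> A \<and> length xs = k}"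
    using a by (intro image_eqI[of _ _ "map a [0..<k]"]) auto
next
  fix s assume "s \<in> sum_list ` {xs. set xs \<subseteq> A \<and> length xs = k}"
  then obtain xs where "s = sum_list xs" "set xs \<subseteq> A" "length xs = k"
    by blast
  then show "s \<in> iterated_sumset k A"
    unfolding iterated_sumset_def
    by (auto simp: sum_list_sum_nth atLeast0LessThan intro!: exI[of _ "(!) xs"])
qed

lemma finite_iterated_sumset: "finite A \<Longrightarrow> finite (iterated_sumset k A)"
  unfolding iterated_sumset_eq_sum_list by (intro finite_imageI finite_lists_length_eq)

lemma card_iterated_sumset_le: "finite A \<Longrightarrow> card (iterated_sumset k A) \<le> card A ^ k"
  unfolding iterated_sumset_eq_sum_list
  by (rule order.trans[OF card_image_le]) (simp_all add: card_lists_length_eq finite_lists_length_eq)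

lemma iterated_sumset_mono: "Y \<subseteq> A \<Longrightarrow> iterated_sumset k Y \<subseteq> iterated_sumset k A"
  unfolding iterated_sumset_eq_sum_list by (intro image_mono) auto

lemma lex_insert_same:
  assumes "length us = length us'" and "(us @ vs, us' @ vs') \<in> lex r"
  shows "(us @ x # vs, us' @ x # vs') \<in> lex r"
  using assms by (induction us us' rule: list_induct2) auto

text \<open>
  The representative of a sum is its lexicographically least expression with respect to a well-order
  of the group. If a list obtained from a representative by deleting an entry \<open>x\<close> were not minimal,
  then inserting \<open>x\<close> at the same position into a smaller list with the same sum would
  produce an expression smaller than the representative.
\<close>
lemma hereditary_representatives:
  fixes A :: "'a::ab_group_add set"
  obtains C :: "'a list set" where
    "\<And>xs. xs \<in> C \<Longrightarrow> set xs \<subseteq> A"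
    and "\<And>k. inj_on sum_list {xs \<in> C. length xs = k}"
    and "\<And>k. sum_list ` {xs \<in> C. length xs = k} = iterated_sumset k A"
    and "\<And>us x vs. us @ x # vs \<in> C \<Longrightarrow> us @ vs \<in> C"
proof -
  obtain r0 :: "'a rel" where r0: "Well_order r0" "Field r0 = UNIV"
    using well_ordering[where 'a = 'a] by (elim exE conjE)
  define r where "r = r0 - Id"
  have wf: "wf r"
    using r0 unfolding r_def well_order_on_def by simp
  have tot: "\<forall>a b. (a, b) \<in> r \<or> a = b \<or> (b, a) \<in> r"
    using r0 unfolding r_def well_order_on_def linear_order_on_def total_on_def by auto
  define C where "C = {xs. set xs \<subseteq> A \<and>
    (\<forall>ys. set ys \<subseteq> A \<longrightarrow> sum_list ys = sum_list xs \<longrightarrow> (ys, xs) \<notin> lex r)}"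
  have minimal: "(ys, xs) \<notin> lex r"
    if "xs \<in> C" "set ys \<subseteq> A" "sum_list ys = sum_list xs" for xs ys
    using that unfolding C_def by simp
  show ?thesis
  proof (rule that)
    show in_A: "set xs \<subseteq> A" if "xs \<in> C" for xs
      using that unfolding C_def by blast
    show "inj_on sum_list {xs \<in> C. length xs = k}" for k
    proof (rule inj_onI)
      fix xs ys
      assume *: "xs \<in> {xs \<in> C. length xs = k}" "ys \<in> {xs \<in> C. length xs = k}"
        "sum_list xs = sum_list ys"
      then have "(xs, ys) \<notin> lex r" "(ys, xs) \<notin> lex r"
        unfolding C_def by auto
      then show "xs = ys"
        using lexord_linear[OF tot, of xs ys] * by (auto simp: lexord_lex)
    qed
    show "sum_list ` {xs \<in> C. length xs = k} = iterated_sumset k A" for k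
    proof
      show "sum_list ` {xs \<in> C. length xs = k} \<subseteq> iterated_sumset k A"
        unfolding iterated_sumset_eq_sum_list C_def by (intro image_mono) auto
      show "iterated_sumset k A \<subseteq> sum_list ` {xs \<in> C. length xs = k}"
      proof
        fix s assume s: "s \<in> iterated_sumset k A"
        define Q where "Q = {xs. set xs \<subseteq> A \<and> length xs = k \<and> sum_list xs = s}"
        from s obtain xs where "xs \<in> Q"
          unfolding iterated_sumset_eq_sum_list Q_def by blast
        with wf_lex[OF wf] obtain zs
          where zs: "zs \<in> Q" and min: "\<And>ys. (ys, zs) \<in> lex r \<Longrightarrow> ys \<notin> Q"
          by (rule wfE_min) blast
        have "zs \<in> C"
          using zs min unfolding C_def Q_def by (auto simp: lexord_lex)
        then show "s \<in> sum_list ` {xs \<in> C. length xs = k}"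
          using zs unfolding Q_def by blast
      qed
    qed
    show "us @ vs \<in> C" if C: "us @ x # vs \<in> C" for us x vs
    proof -
      have False if ys: "set ys \<subseteq> A" "sum_list ys = sum_list (us @ vs)"
        "(ys, us @ vs) \<in> lex r" for ys
      proof -
        define us' vs' where "us' = take (length us) ys" and "vs' = drop (length us) ys"
        have eq: "ys = us' @ vs'" by (simp add: us'_def vs'_def)
        have "length ys = length (us @ vs)"
          using ys(3) by (simp add: lexord_lex)
        then have "length us' = length us"
          by (simp add: us'_def)
        then have "(us' @ x # vs', us @ x # vs) \<in> lex r"
          using ys(3) eq by (intro lex_insert_same) auto
        moreover have "set (us' @ x # vs') \<subseteq> A"
          using ys(1) C unfolding eq C_def by auto
        moreover have "sum_list (us' @ x # vs') = sum_list (us @ x # vs)"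
          using ys(2) unfolding eq by (simp add: algebra_simps)
        ultimately show False
          using minimal[OF C] by metis
      qed
      moreover have "set (us @ vs) \<subseteq> A"
        using in_A[OF C] by simp
      ultimately show ?thesis
        unfolding C_def mem_Collect_eq by metis
    qed
  qed
qed

section \<open>A small subset that captures most of the higher sumset\<close>

text \<open>
  The exponents are those of Loomis--Whitney in dimension \<open>Suc (Suc n)\<close>: removing the first \<open>a\<close>
  from the representatives of length \<open>Suc (Suc n) + 1\<close> through \<open>a\<close> loses none of them, because
  the sum determines a representative, and deleting a further entry gives a representative of length \<open>Suc (Suc n)\<close> through \<open>a\<close>, again
  with its first \<open>a\<close> removed.
\<close>
lemma card_representatives_through_point:
  fixes C :: "'a::ab_group_add list set"
  assumes "finite A" and "\<And>xs. xs \<in> C \<Longrightarrow> set xs \<subseteq> A"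
    and inj: "\<And>k. inj_on sum_list {xs \<in> C. length xs = k}"
    and her: "\<And>us x vs. us @ x # vs \<in> C \<Longrightarrow> us @ vs \<in> C"
  shows "card {xs \<in> C. length xs = Suc (Suc n) + 1 \<and> a \<in> set xs} ^ Suc n \<le>
    card {xs \<in> C. length xs = Suc (Suc n) \<and> a \<in> set xs} ^ Suc (Suc n)"
proof -
  define X where "X k = {xs \<in> C. length xs = k \<and> a \<in> set xs}" for k
  let ?h = "Suc (Suc n)"
  have fin: "finite (X k)" for k
    by (rule finite_subset[OF _ finite_lists_length_eq[OF assms(1), of k]])
      (use assms(2) in \<open>auto simp: X_def\<close>)
  define F where "F = remove1 a ` X (?h + 1)"
  have sum_rm: "sum_list xs = a + sum_list (remove1 a xs)" if "a \<in> set xs" for xs :: "'a list"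
    using that by (rule sum_list_map_remove1[of a xs id, simplified])
  have "inj_on (remove1 a) (X (?h + 1))"
  proof (rule inj_onI)
    fix xs ys assume "xs \<in> X (?h + 1)" "ys \<in> X (?h + 1)" "remove1 a xs = remove1 a ys"
    then show "xs = ys"
      using inj_onD[OF inj[of "?h + 1"], of xs ys] sum_rm[of xs] sum_rm[of ys]
      by (simp add: X_def)
  qed
  then have cardF: "card F = card (X (?h + 1))"
    unfolding F_def by (rule card_image)
  show ?thesis
  proof (cases "F = {}")
    case True
    then have "card (X (?h + 1)) = 0"
      using cardF by simp
    then show ?thesis
      unfolding X_def by simp
  next
    case False
    have lenF: "length ys = ?h" if "ys \<in> F" for ys
      using that unfolding F_def X_def by (auto simp: length_remove1)
    \<comment> \<open>The first \<open>a\<close> splits a representative into \<open>us @ a # vs\<close>; the entry to delete lies in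
      \<open>us\<close> or in \<open>vs\<close>, so the deletion commutes with the removal of this \<open>a\<close>.\<close>
    have shadow: "del_nth j ` F \<subseteq> remove1 a ` X ?h" if j: "j < ?h" for j
    proof
      fix zs assume "zs \<in> del_nth j ` F"
      then obtain xs where xs: "xs \<in> X (?h + 1)" "zs = del_nth j (remove1 a xs)"
        unfolding F_def by blast
      from xs obtain us vs where split: "xs = us @ a # vs" "a \<notin> set us"
        unfolding X_def by (auto dest: split_list_first)
      then have rm: "remove1 a xs = us @ vs"
        by (simp add: remove1_append)
      have len: "length us + length vs = ?h"
        using xs split by (simp add: X_def)
      show "zs \<in> remove1 a ` X ?h"
      proof (cases "j < length us")
        case True
        then have u: "us = take j us @ us ! j # drop (Suc j) us"
          by (rule id_take_nth_drop)
        have "take j us @ us ! j # drop (Suc j) us @ a # vs \<in> C"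
          using xs(1) split u by (simp add: X_def flip: append_Cons append_assoc)
        then have "del_nth j us @ a # vs \<in> C"
          using her by (fastforce simp: del_nth_def)
        moreover have "length (del_nth j us @ a # vs) = ?h"
          using len True by (simp add: del_nth_def)
        ultimately have "del_nth j us @ a # vs \<in> X ?h"
          by (simp add: X_def)
        moreover have "a \<notin> set (del_nth j us)"
          using split(2) by (auto simp: del_nth_def dest: in_set_takeD in_set_dropD)
        then have "remove1 a (del_nth j us @ a # vs) = zs"
          using True xs(2) rm by (simp add: remove1_append del_nth_append)
        ultimately show ?thesis
          by blast
      next
        case False
        define i where "i = j - length us"
        have i: "i < length vs"
          using len j False by (simp add: i_def)
        then have v: "vs = take i vs @ vs ! i # drop (Suc i) vs"
          by (rule id_take_nth_drop)
        have "(us @ a # take i vs) @ vs ! i # drop (Suc i) vs \<in> C"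
          using xs(1) split v by (simp add: X_def)
        from her[OF this] have "us @ a # del_nth i vs \<in> C"
          by (simp add: del_nth_def)
        moreover have "length (us @ a # del_nth i vs) = ?h"
          using len i by (simp add: del_nth_def)
        ultimately have "us @ a # del_nth i vs \<in> X ?h"
          by (simp add: X_def)
        moreover have "remove1 a (us @ a # del_nth i vs) = zs"
          using False xs(2) rm split(2) by (simp add: remove1_append del_nth_append i_def)
        ultimately show ?thesis
          by blast
      qed
    qed
    have "card (del_nth j ` F) \<le> card (X ?h)" if "j < ?h" for j
      using card_mono[OF finite_imageI[OF fin] shadow[OF that]] card_image_le[OF fin, of "remove1 a" ?h]
      by linarith
    then have "(\<Prod>j<?h. real (card (del_nth j ` F))) \<le> (\<Prod>j<?h. real (card (X ?h)))"
      by (intro prod_mono) auto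
    moreover have "real (card F) ^ Suc n \<le> (\<Prod>j<?h. real (card (del_nth j ` F)))"
      using False lenF by (intro loomis_whitney_lists) (auto simp: F_def fin)
    ultimately have "real (card F) ^ Suc n \<le> real (card (X ?h)) ^ ?h"
      by simp
    then have "real (card F ^ Suc n) \<le> real (card (X ?h) ^ ?h)"
      by simp
    then show ?thesis
      unfolding cardF of_nat_le_iff X_def by simp
  qed
qed

lemma ex_top_subset:
  fixes g :: "'a \<Rightarrow> nat"
  assumes "finite A" and "k \<le> card A"
  shows "\<exists>Y\<subseteq>A. card Y = k \<and> (\<forall>y\<in>Y. \<forall>a\<in>A - Y. g a \<le> g y)"
  using assms(2)
proof (induction k)
  case 0
  then show ?case by (intro exI[of _ "{}"]) auto
next
  case (Suc k)
  then obtain Y where Y: "Y \<subseteq> A" "card Y = k" "\<forall>y\<in>Y. \<forall>a\<in>A - Y. g a \<le> g y"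
    by auto
  have finY: "finite Y"
    using Y assms finite_subset by blast
  have "A - Y \<noteq> {}"
    using Y Suc.prems finY by (metis Diff_eq_empty_iff card_mono not_less_eq_eq)
  then have "Max (g ` (A - Y)) \<in> g ` (A - Y)"
    using assms by (intro Max_in) auto
  then obtain b where b: "b \<in> A - Y" "Max (g ` (A - Y)) = g b"
    by blast
  then have "g a \<le> g b" if "a \<in> A - Y" for a
    using that assms by (metis Max_ge finite_Diff finite_imageI imageI)
  then show ?case
    using Y b finY by (intro exI[of _ "insert b Y"]) auto
qed

text \<open>
  In the application \<open>I\<close> is the complement of a set of \<open>k\<close> elements on which \<open>g\<close> is
  largest, and \<open>P\<close> is the sum of \<open>g\<close> over that set. One factor \<open>g a\<close> in the bound on \<open>G a ^ n\<close> is at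
  most \<open>P / k\<close>, so the sum of \<open>G\<close> is controlled by \<open>P\<close> and the sum \<open>U\<close> of \<open>g\<close> over
  \<open>I\<close>. Since \<open>P\<close> and \<open>U\<close> share a fixed budget, \<open>P * U ^ n\<close> is largest when \<open>U = n * P\<close>; this is the
  arithmetic-geometric mean inequality for \<open>P\<close> and \<open>n\<close> copies of \<open>U / n\<close>.
\<close>
lemma sum_power_bound_by_popular:
  fixes G g :: "'a \<Rightarrow> real" and k P N :: real
  assumes "k > 0" and "P \<ge> 0" and "N \<ge> 0" and U: "P + (\<Sum>a\<in>I. g a) \<le> Suc n * N"
    and "n > 0"
    and nonneg: "\<And>a. a \<in> I \<Longrightarrow> 0 \<le> G a" "\<And>a. a \<in> I \<Longrightarrow> 0 \<le> g a"
    and small: "\<And>a. a \<in> I \<Longrightarrow> k * g a \<le> P"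
    and pow: "\<And>a. a \<in> I \<Longrightarrow> G a ^ n \<le> g a ^ Suc n"
  shows "k * (\<Sum>a\<in>I. G a) ^ n \<le> n ^ n * N ^ Suc n"
proof -
  define r where "r = root n (P / k)"
  have r: "r \<ge> 0" "r ^ n = P / k"
    unfolding r_def using assms by auto
  define U where "U = (\<Sum>a\<in>I. g a)"
  have U0: "U \<ge> 0"
    unfolding U_def using nonneg by (intro sum_nonneg)
  have "G a \<le> g a * r" if a: "a \<in> I" for a
  proof -
    have "G a ^ n \<le> g a ^ n * g a"
      using pow[OF a] by (simp add: mult.commute)
    also have "\<dots> \<le> g a ^ n * (P / k)"
      using small[OF a] nonneg[OF a] \<open>k > 0\<close>
      by (intro mult_left_mono) (auto simp: field_simps)
    also have "\<dots> = (g a * r) ^ n"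
      by (simp add: power_mult_distrib r)
    finally show ?thesis
      using power_le_imp_le_base[of "G a" "n - 1" "g a * r"] nonneg[OF a] r \<open>n > 0\<close> by simp
  qed
  then have "(\<Sum>a\<in>I. G a) \<le> U * r"
    unfolding U_def sum_distrib_right by (intro sum_mono)
  then have "(\<Sum>a\<in>I. G a) ^ n \<le> (U * r) ^ n"
    using nonneg by (intro power_mono sum_nonneg)
  then have "k * (\<Sum>a\<in>I. G a) ^ n \<le> P * U ^ n"
    using \<open>k > 0\<close> r by (simp add: power_mult_distrib field_simps)
  also have "P * U ^ n = n ^ n * (P * (U / n) ^ n)"
    using \<open>n > 0\<close> by (simp add: power_divide)
  also have "P * (U / n) ^ n = (\<Prod>j<Suc n. if j = 0 then P else U / n)"
    by (subst prod.lessThan_Suc_shift) simp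
  also have "\<dots> \<le> ((\<Sum>j<Suc n. if j = 0 then P else U / n) / Suc n) ^ Suc n"
    using \<open>P \<ge> 0\<close> U0 by (intro prod_le_mean_power) auto
  also have "(\<Sum>j<Suc n. if j = 0 then P else U / n) = P + U"
    using \<open>n > 0\<close> by (subst sum.lessThan_Suc_shift) simp
  also have "((P + U) / Suc n) ^ Suc n \<le> N ^ Suc n"
    using U U0 \<open>P \<ge> 0\<close> unfolding U_def[symmetric]
    by (intro power_mono) (auto simp: field_simps)
  finally show ?thesis
    using \<open>n > 0\<close> by simp
qed

text \<open>
  The set \<open>Y\<close> consists of the \<open>k\<close> elements that occur in the most representatives of \<open>hA\<close>. An
  element of \<open>(h+1)A\<close> can be missing from \<open>(h+1)Y\<close> only if its representative uses an element
  outside \<open>Y\<close>, and few representatives do.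
\<close>
lemma ex_subset_capturing_sumset:
  fixes A :: "'a::ab_group_add set"
  assumes "finite A" and "0 < k" and "k \<le> card A" and "h \<ge> 2"
  shows "\<exists>Y\<subseteq>A. card Y = k \<and>
    real k * (real (card (iterated_sumset (h + 1) A)) - real (card (iterated_sumset (h + 1) Y))) ^ (h - 1)
      \<le> real (h - 1) ^ (h - 1) * real (card (iterated_sumset h A)) ^ h"
proof -
  obtain C :: "'a list set" where C:
    "\<And>xs. xs \<in> C \<Longrightarrow> set xs \<subseteq> A"
    "\<And>k. inj_on sum_list {xs \<in> C. length xs = k}"
    "\<And>k. sum_list ` {xs \<in> C. length xs = k} = iterated_sumset k A"
    "\<And>us x vs. us @ x # vs \<in> C \<Longrightarrow> us @ vs \<in> C"
    using hereditary_representatives[of A] by blast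
  define D where "D l = {xs \<in> C. length xs = l}" for l
  define g where "g l a = card {xs \<in> D l. a \<in> set xs}" for l a
  have finD: "finite (D l)" for l
    by (rule finite_subset[OF _ finite_lists_length_eq[OF assms(1), of l]])
      (use C(1) in \<open>auto simp: D_def\<close>)
  have cardD: "card (D l) = card (iterated_sumset l A)" for l
    using card_image[OF C(2)[of l]] C(3)[of l] by (simp add: D_def)
  have g_def': "g l a = card {xs \<in> C. length xs = l \<and> a \<in> set xs}" for l a
    unfolding g_def D_def by (simp add: conj_assoc)
  obtain n where h: "h = Suc n" and n: "n > 0"
    using \<open>h \<ge> 2\<close> by (cases h) auto
  have pow: "g (h + 1) a ^ n \<le> g h a ^ Suc n" for a
  proof -
    obtain m where "n = Suc m" using n by (cases n) auto
    then show ?thesis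
      using card_representatives_through_point[where n = m and a = a, OF assms(1) C(1) C(2) C(4)]
      unfolding g_def' h by simp
  qed
  obtain Y where Y: "Y \<subseteq> A" "card Y = k" "\<forall>y\<in>Y. \<forall>a\<in>A - Y. g h a \<le> g h y"
    using ex_top_subset[OF assms(1,3)] by blast
  have finY: "finite Y"
    using Y(1) assms(1) finite_subset by blast
  have "(\<Sum>a\<in>A. g h a) = (\<Sum>a\<in>A. \<Sum>xs\<in>D h. if a \<in> set xs then 1 else 0)"
    unfolding g_def by (simp add: sum.If_cases finD Int_def)
  also have "\<dots> = (\<Sum>xs\<in>D h. \<Sum>a\<in>A. if a \<in> set xs then 1 else 0)"
    by (rule sum.swap)
  also have "\<dots> \<le> (\<Sum>xs\<in>D h. h)"
  proof (rule sum_mono)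
    fix xs assume "xs \<in> D h"
    then have "card (A \<inter> set xs) \<le> length xs" "length xs = h"
      by (auto simp: D_def intro: order.trans[OF card_mono card_length])
    then show "(\<Sum>a\<in>A. if a \<in> set xs then 1 else 0) \<le> h"
      using assms(1) by (simp add: sum.If_cases Int_def)
  qed
  \<comment> \<open>A representative of length \<open>h\<close> passes through at most \<open>h\<close> elements.\<close>
  finally have total: "(\<Sum>a\<in>A. g h a) \<le> h * card (iterated_sumset h A)"
    by (simp add: cardD mult.commute)
  have "(\<Sum>a\<in>A. g h a) = (\<Sum>a\<in>Y. g h a) + (\<Sum>a\<in>A - Y. g h a)"
    using sum.subset_diff[OF Y(1) assms(1), of "g h"] by simp
  then have total': "(\<Sum>a\<in>Y. g h a) + (\<Sum>a\<in>A - Y. g h a) \<le> h * card (iterated_sumset h A)"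
    using total by simp
  have small: "k * g h a \<le> (\<Sum>y\<in>Y. g h y)" if "a \<in> A - Y" for a
    using sum_bounded_below[of Y "g h a" "g h"] Y that by auto
  have "iterated_sumset (h + 1) A \<subseteq> iterated_sumset (h + 1) Y \<union>
      sum_list ` (\<Union>a\<in>A - Y. {xs \<in> D (h + 1). a \<in> set xs})"
  proof
    fix s assume "s \<in> iterated_sumset (h + 1) A"
    then obtain xs where xs: "xs \<in> D (h + 1)" "s = sum_list xs"
      using C(3)[of "h + 1"] unfolding D_def by blast
    show "s \<in> iterated_sumset (h + 1) Y \<union>
      sum_list ` (\<Union>a\<in>A - Y. {xs \<in> D (h + 1). a \<in> set xs})"
    proof (cases "set xs \<subseteq> Y")
      case True
      then show ?thesis
        using xs unfolding iterated_sumset_eq_sum_list D_def by blast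
    next
      case False
      then obtain a where "a \<in> set xs" "a \<in> A - Y"
        using xs(1) C(1) unfolding D_def by blast
      then show ?thesis
        using xs by blast
    qed
  qed
  then have "card (iterated_sumset (h + 1) A) \<le> card (iterated_sumset (h + 1) Y \<union>
      sum_list ` (\<Union>a\<in>A - Y. {xs \<in> D (h + 1). a \<in> set xs}))"
    using assms(1) finD finY by (intro card_mono) (auto intro: finite_iterated_sumset)
  also have "\<dots> \<le> card (iterated_sumset (h + 1) Y) +
      card (sum_list ` (\<Union>a\<in>A - Y. {xs \<in> D (h + 1). a \<in> set xs}))"
    by (rule card_Un_le)
  also have "card (sum_list ` (\<Union>a\<in>A - Y. {xs \<in> D (h + 1). a \<in> set xs})) \<le>
      card (\<Union>a\<in>A - Y. {xs \<in> D (h + 1). a \<in> set xs})"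
    using assms(1) finD by (intro card_image_le) auto
  also have "\<dots> \<le> (\<Sum>a\<in>A - Y. g (h + 1) a)"
    unfolding g_def using assms(1) by (intro card_UN_le) auto
  finally have lost: "card (iterated_sumset (h + 1) A) \<le>
      card (iterated_sumset (h + 1) Y) + (\<Sum>a\<in>A - Y. g (h + 1) a)"
    by simp
  have mono: "card (iterated_sumset (h + 1) Y) \<le> card (iterated_sumset (h + 1) A)"
    using assms(1) Y(1) by (intro card_mono finite_iterated_sumset iterated_sumset_mono)
  have "real k * (real (card (iterated_sumset (h + 1) A)) - real (card (iterated_sumset (h + 1) Y))) ^ n
      \<le> real k * (\<Sum>a\<in>A - Y. real (g (h + 1) a)) ^ n"
    using lost mono unfolding of_nat_sum[symmetric]
    by (intro mult_left_mono power_mono) linarith+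
  also have "\<dots> \<le> real n ^ n * real (card (iterated_sumset h A)) ^ Suc n"
  proof (rule sum_power_bound_by_popular[where P = "real (\<Sum>y\<in>Y. g h y)" and g = "\<lambda>a. real (g h a)"])
    have "real ((\<Sum>a\<in>Y. g h a) + (\<Sum>a\<in>A - Y. g h a)) \<le> real (h * card (iterated_sumset h A))"
      using total' by (intro of_nat_mono)
    then show "real (\<Sum>y\<in>Y. g h y) + (\<Sum>a\<in>A - Y. real (g h a)) \<le> real (Suc n) * real (card (iterated_sumset h A))"
      unfolding h[symmetric] by simp
    show "real k * real (g h a) \<le> real (\<Sum>y\<in>Y. g h y)" if "a \<in> A - Y" for a
      using small[OF that] by (metis of_nat_mono of_nat_mult)
    show "real (g (h + 1) a) ^ n \<le> real (g h a) ^ Suc n" for a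
      using pow[of a] by (metis of_nat_mono of_nat_power)
  qed (use n assms in \<open>auto intro: sum_nonneg\<close>)
  finally show ?thesis
    using Y by (intro exI[of _ Y]) (simp add: h)
qed

section \<open>The near-extremal case\<close>

lemma two_mult_power_self_le:
  assumes "n > 0"
  shows "2 * real n ^ n \<le> real (Suc n) ^ n"
proof -
  have "1 + real n * (1 / real n) \<le> (1 + 1 / real n) ^ n"
    by (rule Bernoulli_inequality) (use assms in \<open>auto intro: order.trans[of _ 0]\<close>)
  then have "2 * real n ^ n \<le> (1 + 1 / real n) ^ n * real n ^ n"
    using assms by (intro mult_right_mono) auto
  also have "\<dots> = ((1 + 1 / real n) * real n) ^ n"
    by (simp add: power_mult_distrib)
  also have "(1 + 1 / real n) * real n = real (Suc n)"
    using assms by (simp add: field_simps)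
  finally show ?thesis .
qed

theorem theorem6p2:
  fixes A :: "'a::ab_group_add set" and h :: nat and \<alpha> M :: real
  assumes "finite A" and "A \<noteq> {}" and "h \<ge> 2"
    and "real (card (iterated_sumset h A)) \<le> \<alpha> * real (card A)"
    and "real (card (iterated_sumset (h + 1) A)) \<ge>
      1 / M * \<alpha> powr (real (h + 1) / real h) * real (card A) powr (real (h + 1) / real h)"
    and "1 \<le> M"
    and "M \<le> 1 / (2 * real h) *
      (real (card A) / \<alpha> powr (1 / (real h - 1))) powr (1 / real h)"
  shows "\<exists>Y \<subseteq> A.
      (\<alpha> * real (card A)) powr (1 / real h) / (2 * M) powr (1 / real h) \<le> real (card Y) \<and>
      real (card Y) < (2 * M * real h) ^ (h - 1) * (\<alpha> * real (card A)) powr (1 / real h) \<and>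
      real (card (iterated_sumset (h + 1) Y)) \<ge>
        real (card Y) ^ (h + 1) / ((2 * M) ^ (h\<^sup>2) * real h ^ (h\<^sup>2 - 1))"
proof -
  obtain n where h: "h = Suc n" and n: "n > 0"
    using assms(3) by (cases h) auto
  define m where "m = real (card A)"
  define N where "N = \<alpha> * m"
  define q where "q = N powr (1 / real h)"
  define K where "K = (2 * M * real h) ^ n * q"
  have m: "m \<ge> 1"
    unfolding m_def using assms(1,2) by (simp add: Suc_le_eq card_gt_0_iff)
  have "iterated_sumset h A \<noteq> {}"
    using assms(2) unfolding iterated_sumset_def by auto
  then have "card (iterated_sumset h A) > 0"
    using assms(1) by (simp add: card_gt_0_iff finite_iterated_sumset)
  then have N1: "N \<ge> 1"
    using assms(4) unfolding N_def m_def by linarith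
  have \<alpha>: "\<alpha> > 0"
    using N1 m unfolding N_def by (metis less_le_trans zero_less_mult_pos2 zero_less_one)
  have q1: "q \<ge> 1"
    unfolding q_def using N1 by (simp add: ge_one_powr_ge_zero)
  have qh: "q ^ h = N"
    unfolding q_def using N1 assms(3) by (simp add: powr_power)
  have "\<alpha> powr (real (h + 1) / real h) * m powr (real (h + 1) / real h) = N powr (real (h + 1) / real h)"
    unfolding N_def using \<alpha> m by (simp add: powr_mult)
  also have "\<dots> = q powr real (h + 1)"
    unfolding q_def by (simp add: powr_powr)
  also have "\<dots> = q ^ (h + 1)"
    using q1 by (intro powr_realpow) simp
  finally have large: "real (card (iterated_sumset (h + 1) A)) \<ge> q ^ (h + 1) / M"
    using assms(5) unfolding m_def by (simp add: mult.assoc)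

  \<comment> \<open>Raised to the power \<open>h * n\<close>, the upper bound on \<open>M\<close> becomes \<open>K ^ h \<le> m ^ h\<close>.\<close>
  have "K \<le> m"
  proof -
    define b where "b = \<alpha> powr (1 / real n)"
    have b: "b > 0" "b ^ n = \<alpha>"
      unfolding b_def using \<alpha> n by (auto simp: powr_power)
    have "2 * M * real h \<le> (m / b) powr (1 / real h)"
      using assms(7) unfolding m_def b_def h by (simp add: field_simps)
    then have "(2 * M * real h) ^ h \<le> ((m / b) powr (1 / real h)) ^ h"
      using assms(6) by (intro power_mono) auto
    also have "\<dots> = m / b"
      using m b assms(3) by (simp add: powr_power)
    finally have "(2 * M * real h) ^ h * b \<le> m"
      using b by (simp add: field_simps)
    then have "((2 * M * real h) ^ h * b) ^ n \<le> m ^ n"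
      using b assms(6) by (intro power_mono) auto
    then have "((2 * M * real h) ^ h) ^ n * \<alpha> \<le> m ^ n"
      by (simp add: power_mult_distrib b)
    then have "((2 * M * real h) ^ h) ^ n * \<alpha> * m \<le> m ^ n * m"
      using m by (intro mult_right_mono) auto
    moreover have "K ^ h = ((2 * M * real h) ^ h) ^ n * \<alpha> * m"
      unfolding K_def power_mult_distrib[of _ q] qh N_def
      by (simp add: power_mult[symmetric] mult.commute mult.left_commute)
    ultimately have "K ^ Suc n \<le> m ^ Suc n"
      by (simp add: h mult.commute)
    then show ?thesis
      using power_le_imp_le_base m by fastforce
  qed
  have "4 \<le> 2 * M * real h"
    using mult_mono[of 2 "2 * M" 2 "real h"] assms(3,6) by simp
  also have "\<dots> \<le> (2 * M * real h) ^ n"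
    using calculation n by (intro self_le_power) auto
  also have "\<dots> \<le> K"
    unfolding K_def using mult_left_mono[OF q1, of "(2 * M * real h) ^ n"] assms(6) by simp
  finally have K4: "K \<ge> 4" .
  \<comment> \<open>The largest integer below \<open>K\<close>: the size bound is strict.\<close>
  define k where "k = nat (\<lceil>K\<rceil> - 1)"
  have k: "real k < K" "K - 1 \<le> real k"
    unfolding k_def using K4 by linarith+
  have "k > 0" "k \<le> card A" "K / 2 \<le> real k"
    using k K4 \<open>K \<le> m\<close> unfolding m_def by linarith+
  then obtain Y where Y: "Y \<subseteq> A" "card Y = k" and
    Ylost: "real k * (real (card (iterated_sumset (h + 1) A)) - real (card (iterated_sumset (h + 1) Y))) ^ n
      \<le> real n ^ n * real (card (iterated_sumset h A)) ^ h"
    using ex_subset_capturing_sumset[OF assms(1) _ _ assms(3), of k] unfolding h by auto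
  define l where "l = real (card (iterated_sumset (h + 1) A)) - real (card (iterated_sumset (h + 1) Y))"
  define L where "L = q ^ (h + 1) / (2 * M)"
  have L0: "L > 0"
    unfolding L_def using q1 assms(6) by simp
  have "l \<le> L"
  proof (rule ccontr)
    assume "\<not> l \<le> L"
    then have "L ^ n < l ^ n"
      using L0 n by (intro power_strict_mono) auto
    then have "K / 2 * L ^ n < K / 2 * l ^ n"
      using K4 by simp
    also have "\<dots> \<le> real k * l ^ n"
      using \<open>K / 2 \<le> real k\<close> \<open>\<not> l \<le> L\<close> L0 by (intro mult_right_mono) auto
    also have "\<dots> \<le> real n ^ n * real (card (iterated_sumset h A)) ^ h"
      unfolding l_def by (rule Ylost)
    also have "\<dots> \<le> real n ^ n * N ^ h"
      using assms(4) unfolding N_def m_def by (intro mult_left_mono power_mono) auto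
    finally have "K / 2 * L ^ n < real n ^ n * N ^ h" .
    moreover have "K / 2 * L ^ n = real h ^ n * N ^ h / 2"
    proof -
      have "K * L ^ n = (2 * M * real h * L) ^ n * q"
        by (simp add: K_def power_mult_distrib)
      also have "2 * M * real h * L = real h * q ^ (h + 1)"
        unfolding L_def using assms(6) by simp
      also have "(real h * q ^ (h + 1)) ^ n * q = real h ^ n * q ^ ((h + 1) * n + 1)"
        by (simp only: power_mult_distrib power_mult power_add power_one_right mult.assoc)
      also have "(h + 1) * n + 1 = h * h"
        by (simp add: h)
      finally show ?thesis
        by (simp add: power_mult qh)
    qed
    ultimately have "real h ^ n * N ^ h < (2 * real n ^ n) * N ^ h"
      by simp
    also have "\<dots> \<le> real h ^ n * N ^ h"
      using two_mult_power_self_le[OF n] N1 unfolding h by (intro mult_right_mono) auto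
    finally show False by simp
  qed
  have YL: "L \<le> real (card (iterated_sumset (h + 1) Y))"
  proof -
    have "q ^ (h + 1) / M = 2 * L"
      by (simp add: L_def)
    then show ?thesis
      using large \<open>l \<le> L\<close> unfolding l_def by linarith
  qed

  have "q / (2 * M) powr (1 / real h) \<le> real k"
  proof -
    define p where "p = (2 * M) powr (1 / real h)"
    have p: "p \<ge> 1" "p ^ h = 2 * M"
      unfolding p_def using assms(3,6) by (auto simp: powr_power ge_one_powr_ge_zero)
    have "(q / p) ^ (h + 1) = L / p"
      unfolding L_def power_divide using p by simp
    also have "\<dots> \<le> L"
      using p L0 by (simp add: divide_le_eq mult_le_cancel_left1)
    also have "\<dots> \<le> real (card (iterated_sumset (h + 1) Y))"
      by (rule YL)
    also have "\<dots> \<le> real (k ^ (h + 1))"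
      using card_iterated_sumset_le[of Y "h + 1"] Y finite_subset[OF Y(1) assms(1)]
      by (intro of_nat_mono) simp
    finally have "(q / p) ^ Suc h \<le> real k ^ Suc h"
      by simp
    then have "q / p \<le> real k"
      by (rule power_le_imp_le_base) simp
    then show ?thesis
      by (simp add: p_def)
  qed
  moreover have "real k ^ (h + 1) / ((2 * M) ^ (h\<^sup>2) * real h ^ (h\<^sup>2 - 1)) \<le>
      real (card (iterated_sumset (h + 1) Y))"
  proof -
    have e: "h\<^sup>2 = Suc (n * (h + 1))"
      by (simp add: h power2_eq_square)
    have "real k ^ (h + 1) \<le> K ^ (h + 1)"
      using k by (intro power_mono) auto
    also have "K ^ (h + 1) = (2 * M * real h) ^ (n * (h + 1)) * q ^ (h + 1)"
      by (simp only: K_def power_mult_distrib[of _ q] power_mult)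
    also have "\<dots> = L * ((2 * M) ^ (h\<^sup>2) * real h ^ (h\<^sup>2 - 1))"
      unfolding e L_def power_mult_distrib[of "2 * M"] using assms(6) by simp
    finally have "real k ^ (h + 1) / ((2 * M) ^ (h\<^sup>2) * real h ^ (h\<^sup>2 - 1)) \<le> L"
      using assms(3,6) by (subst pos_divide_le_eq) (auto simp: mult.commute)
    then show ?thesis
      using YL by linarith
  qed
  ultimately show ?thesis
    using Y k(1) unfolding K_def q_def N_def m_def h
    by (intro exI[of _ Y]) simp
qed

end
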